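(* Let $k\ge 2$, let $m=r\ge 0$ be an integer with $m+r\le k-2$, and let $$\lambda_{cr}=\left(\frac{k-2m}{k-2m-1}\right)^k\cdot\frac{1}{k-2m-1}.$$ Then for the HC-model with $\lambda>\lambda_{cr}$ there are at least three Gibbs measures (corresponding to solutions $(h,l)$ for the parameters $m,r$), one of which is TI and the others are AGMs that are not TI.
   Context: Half-tree: let $V$ be the vertex set of the infinite rooted tree with root $x^0$ in which every vertex $x$ has exactly $k$ direct successors, forming the set $S(x)$ (so the root has $k$ nearest neighbours and every other vertex has $k+1$). $W_n$ is the set of vertices at distance $n$ from $x^0$, and $V_n=\bigcup_{j=0}^n W_j$. HC-model (hard-core model): a configuration $\sigma: V\to\{0,1\}$ is admissible if $\sigma(x)\sigma(y)=0$ for all nearest neighbours $x,y$; $\Omega$ (resp. $\Omega_{V_n}$) is the set of admissible configurations on $V$ (resp. $V_n$). For $\sigma_n\in\Omega_{V_n}$, $\#\sigma_n$ is the number of $x\in V_n$ with $\sigma_n(x)=1$. For $\lambda>0$ and a positive function $z: x\mapsto z_x$ on $V$, put $z_{0,x}=1$, $z_{1,x}=z_x$ and $\mu^{(n)}(\sigma_n)=\frac1{Z_n}\lambda^{\#\sigma_n}\prod_{x\in W_n}z_{\sigma_n(x),x}$ on $\Omega_{V_n}$, with $Z_n$ the normalizing constant. If $z_x=\prod_{y\in S(x)}(1+\lambda z_y)^{-1}$ for all $x\in V$, these measures are consistent and define a unique probability measure on $\Omega$ with marginals $\mu^{(n)}$, the (splitting) Gibbs measure corresponding to $z$. It is translation-invariant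 (TI) if $z_x$ is constant. Alternative Gibbs measures (AGM) with parameters $m,r$ ($0\le m,r\le k$ integers): consider functions $z$ taking values in $\{h,l\}$ such that if $z_x=h$ then $z_y=h$ on $m$ vertices $y$ of $S(x)$ and $z_y=l$ on the remaining $k-m$; and if $z_x=l$ then $z_y=l$ on $r$ vertices $y$ of $S(x)$ and $z_y=h$ on the remaining $k-r$. The arrangement (which vertices get the symbol $h$ and which $l$) is fixed. Such $z$ satisfies the equation above when $h>0$, $l>0$ solve $$h=\frac{1}{(1+\lambda h)^m(1+\lambda l)^{k-m}},\qquad l=\frac{1}{(1+\lambda l)^r(1+\lambda h)^{k-r}}.$$ Each solution $(h,l)$ of this system gives one Gibbs measure; solutions with $h=l$ give a TI measure, and solutions with $h\ne l$ give AGMs which are "not TI". *)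

theory Defs
  imports "HOL-Probability.Probability"
begin

text \<open>
  The half-tree: a vertex is the list of the choices made along the path to it from the root
  \<^term>\<open>[]\<close>, the most recent choice first. The distance of a vertex from the root is its length.
\<close>

type_synonym vertex = "nat list"

definition verts :: "nat \<Rightarrow> vertex set" where
  "verts k = lists {..<k}"

definition succs :: "nat \<Rightarrow> vertex \<Rightarrow> vertex set" where
  "succs k x = (\<lambda>i. i # x) ` {..<k}"

definition neighbours :: "nat \<Rightarrow> vertex \<Rightarrow> vertex \<Rightarrow> bool" where
  "neighbours k x y \<longleftrightarrow> y \<in> succs k x \<or> x \<in> succs k y"

definition sphere_verts :: "nat \<Rightarrow> nat \<Rightarrow> vertex set" where
  "sphere_verts k n = {x \<in> verts k. length x = n}"

definition ball_verts :: "nat \<Rightarrow> nat \<Rightarrow> vertex set" where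
  "ball_verts k n = (\<Union>j\<le>n. sphere_verts k j)"

text \<open>
  Configurations on \<open>A\<close> are extensional functions, so that they are points of the product space
  over \<open>A\<close> and distinct functions are distinct configurations.
\<close>

definition admissible :: "nat \<Rightarrow> vertex set \<Rightarrow> (vertex \<Rightarrow> nat) set" where
  "admissible k A =
     {\<sigma> \<in> A \<rightarrow>\<^sub>E {0, 1}. \<forall>x\<in>A. \<forall>y\<in>A. neighbours k x y \<longrightarrow> \<sigma> x * \<sigma> y = 0}"

definition config_space :: "nat \<Rightarrow> (vertex \<Rightarrow> nat) measure" where
  "config_space k =
     restrict_space (Pi\<^sub>M (verts k) (\<lambda>_. count_space {0, 1})) (admissible k (verts k))"

definition occupied :: "nat \<Rightarrow> nat \<Rightarrow> (vertex \<Rightarrow> nat) \<Rightarrow> nat" where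
  "occupied k n \<sigma> = card {x \<in> ball_verts k n. \<sigma> x = 1}"

definition hc_weight :: "nat \<Rightarrow> real \<Rightarrow> (vertex \<Rightarrow> real) \<Rightarrow> nat \<Rightarrow> (vertex \<Rightarrow> nat) \<Rightarrow> real" where
  "hc_weight k lam z n \<sigma> =
     lam ^ occupied k n \<sigma> * (\<Prod>x\<in>sphere_verts k n. if \<sigma> x = 1 then z x else 1)"

definition hc_marginal :: "nat \<Rightarrow> real \<Rightarrow> (vertex \<Rightarrow> real) \<Rightarrow> nat \<Rightarrow> (vertex \<Rightarrow> nat) \<Rightarrow> real" where
  "hc_marginal k lam z n \<sigma> =
     hc_weight k lam z n \<sigma> / (\<Sum>\<tau>\<in>admissible k (ball_verts k n). hc_weight k lam z n \<tau>)"

definition boundary_law :: "nat \<Rightarrow> real \<Rightarrow> (vertex \<Rightarrow> real) \<Rightarrow> bool" where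
  "boundary_law k lam z \<longleftrightarrow>
     (\<forall>x\<in>verts k. z x > 0 \<and> z x = (\<Prod>y\<in>succs k x. inverse (1 + lam * z y)))"

text \<open>
  A predicate rather than a function of \<open>z\<close>: the marginals determine \<open>M\<close>, and the existence of
  such an \<open>M\<close> (the consistency of the marginals) is not built into the definition.
\<close>

definition gibbs_measure :: "nat \<Rightarrow> real \<Rightarrow> (vertex \<Rightarrow> real) \<Rightarrow> (vertex \<Rightarrow> nat) measure \<Rightarrow> bool" where
  "gibbs_measure k lam z M \<longleftrightarrow>
     boundary_law k lam z \<and>
     prob_space M \<and> space M = space (config_space k) \<and> sets M = sets (config_space k) \<and>
     (\<forall>n. \<forall>\<sigma>\<in>admissible k (ball_verts k n).
        measure M {\<omega> \<in> space M. restrict \<omega> (ball_verts k n) = \<sigma>} = hc_marginal k lam z n \<sigma>)"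

text \<open>
  Translation invariance is a property of the measure: it corresponds to some constant function,
  however it was presented originally.
\<close>

definition TI_gibbs_measure :: "nat \<Rightarrow> real \<Rightarrow> (vertex \<Rightarrow> nat) measure \<Rightarrow> bool" where
  "TI_gibbs_measure k lam M \<longleftrightarrow> (\<exists>z c. (\<forall>x\<in>verts k. z x = c) \<and> gibbs_measure k lam z M)"

text \<open>
  An arrangement says which vertices carry the symbol \<open>h\<close> (value \<^term>\<open>True\<close>) and which carry \<open>l\<close>.
\<close>

definition arrangement :: "nat \<Rightarrow> nat \<Rightarrow> nat \<Rightarrow> (vertex \<Rightarrow> bool) \<Rightarrow> bool" where
  "arrangement k m r a \<longleftrightarrow>
     (\<forall>x\<in>verts k.
        (a x \<longrightarrow> card {y \<in> succs k x. a y} = m \<and> card {y \<in> succs k x. \<not> a y} = k - m) \<and>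
        (\<not> a x \<longrightarrow> card {y \<in> succs k x. \<not> a y} = r \<and> card {y \<in> succs k x. a y} = k - r))"

definition hl_function :: "(vertex \<Rightarrow> bool) \<Rightarrow> real \<Rightarrow> real \<Rightarrow> vertex \<Rightarrow> real" where
  "hl_function a h l x = (if a x then h else l)"

definition hl_solution :: "nat \<Rightarrow> real \<Rightarrow> nat \<Rightarrow> nat \<Rightarrow> real \<Rightarrow> real \<Rightarrow> bool" where
  "hl_solution k lam m r h l \<longleftrightarrow>
     h > 0 \<and> l > 0 \<and>
     h = 1 / ((1 + lam * h) ^ m * (1 + lam * l) ^ (k - m)) \<and>
     l = 1 / ((1 + lam * l) ^ r * (1 + lam * h) ^ (k - r))"

definition hl_gibbs_measure ::
  "nat \<Rightarrow> real \<Rightarrow> nat \<Rightarrow> nat \<Rightarrow> (vertex \<Rightarrow> bool) \<Rightarrow> real \<Rightarrow> real \<Rightarrow> (vertex \<Rightarrow> nat) measure \<Rightarrow> bool" where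
  "hl_gibbs_measure k lam m r a h l M \<longleftrightarrow>
     hl_solution k lam m r h l \<and> gibbs_measure k lam (hl_function a h l) M"

definition lambda_cr :: "nat \<Rightarrow> nat \<Rightarrow> real" where
  "lambda_cr k m =
     ((real k - 2 * real m) / (real k - 2 * real m - 1)) ^ k * (1 / (real k - 2 * real m - 1))"

text \<open>Arrangements exist, so quantifying over all of them is not vacuous.\<close>

primrec example_arrangement :: "nat \<Rightarrow> nat \<Rightarrow> vertex \<Rightarrow> bool" where
  "example_arrangement m r [] = True"
| "example_arrangement m r (i # x) = (if example_arrangement m r x then i < m else \<not> i < r)"

lemma arrangement_exists:
  assumes "m \<le> k" and "r \<le> k"
  shows "\<exists>a. arrangement k m r a"
proof -
  have card_succs: "card {y \<in> succs k x. P y} = card {i \<in> {..<k}. P (i # x)}" for x P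
  proof -
    have "{y \<in> succs k x. P y} = (\<lambda>i. i # x) ` {i \<in> {..<k}. P (i # x)}"
      by (auto simp: succs_def)
    then show ?thesis by (simp add: card_image inj_on_def)
  qed
  have below: "card {i \<in> {..<k}. i < j} = j" and above: "card {i \<in> {..<k}. \<not> i < j} = k - j"
    if "j \<le> k" for j
  proof -
    have "{i \<in> {..<k}. i < j} = {..<j}" and "{i \<in> {..<k}. \<not> i < j} = {j..<k}"
      using that by auto
    then show "card {i \<in> {..<k}. i < j} = j" and "card {i \<in> {..<k}. \<not> i < j} = k - j"
      by simp_all
  qed
  have "arrangement k m r (example_arrangement m r)"
    unfolding arrangement_def card_succs
    using below[OF assms(1)] above[OF assms(1)] below[OF assms(2)] above[OF assms(2)] by simp
  then show ?thesis by blast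
qed

end

theory Submission
  imports Defs
begin

text \<open>
  Three things are needed: solutions of the two equations, measures belonging to them, and a reason
  why the measures differ.

  Solutions. Put \<open>u = 1 + \<lambda>h\<close>, \<open>v = 1 + \<lambda>l\<close> and \<open>d = k - 2m \<ge> 2\<close>. For \<open>m = r\<close> the two equations are
  equivalent to \<open>(u - 1) u\<^sup>m v\<^bsup>k-m\<^esup> = \<lambda>\<close> together with \<open>(u - 1) / u\<^sup>d = (v - 1) / v\<^sup>d\<close>. On the ray
  \<open>v = t u\<close>, \<open>t \<noteq> 1\<close>, the second one becomes linear in \<open>u\<close> after cancelling \<open>u\<^sup>d\<close>, and its solution
  \<open>u = (t\<^sup>d - 1) / (t\<^sup>d - t)\<close> turns the first one into an equation \<open>\<lambda>(t) = \<lambda>\<close> in \<open>t\<close> alone. The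
  function \<open>\<lambda>(t)\<close> extends continuously to \<open>t = 1\<close>, where its value is exactly the critical one, and
  for \<open>t \<ge> 1\<close> it is at least \<open>t / (d - 1)\<close>; so every \<open>\<lambda>\<close> above the critical value is attained at some \<open>t > 1\<close>
  (\<open>lambda_param_surj\<close>). As the system is symmetric in \<open>h\<close> and \<open>l\<close>, this gives two asymmetric
  solutions; a symmetric one comes from the intermediate value theorem.

  Measures. A boundary law \<open>z\<close> describes a branching Markov chain: toss independent coins
  with success probability \<open>\<lambda>z\<^sub>x / (1 + \<lambda>z\<^sub>x)\<close> at all vertices and occupy a vertex iff its coin
  succeeds and its parent is empty. The law of this configuration has the prescribed marginals
  (\<open>gibbs_measure_exists\<close>): the equation for \<open>z\<close> says precisely that the coins ignored below an
  occupied vertex \<open>x\<close> are accounted for by the factor \<open>z\<^sub>x\<close>. This replaces an appeal to Kolmogorov's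
  extension theorem by an infinite product measure.

  Distinctness. The odds of the root being occupied are \<open>\<lambda>z\<close> at the root, so the measure determines
  the value of \<open>z\<close> there (\<open>gibbs_measure_root_unique\<close>). If an asymmetric solution gave a
  translation-invariant measure, \<open>h\<close> or \<open>l\<close> would solve the constant equation, which forces \<open>h = l\<close>
  (\<open>hl_solution_with_constant_value\<close>); and the two asymmetric solutions have different root values.
\<close>

section \<open>Solutions of the two-value equations\<close>

definition geom_sum :: "nat \<Rightarrow> real \<Rightarrow> real" where
  "geom_sum d t = (\<Sum>i<d. t ^ i)"

lemma geom_sum_Suc_shift: "geom_sum (Suc d) t = 1 + t * geom_sum d t"
  by (simp add: geom_sum_def sum.lessThan_Suc_shift sum_distrib_left del: sum.lessThan_Suc)

lemma geom_sum_Suc: "geom_sum (Suc d) t = geom_sum d t + t ^ d"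
  by (simp add: geom_sum_def)

lemma geom_sum_ge_1: "d > 0 \<Longrightarrow> t \<ge> 0 \<Longrightarrow> geom_sum d t \<ge> 1"
  using geom_sum_Suc_shift[of "d - 1" t]
  by (simp add: geom_sum_def sum_nonneg)

lemma geom_sum_le:
  assumes "t \<ge> 1"
  shows "geom_sum (Suc d) t \<le> real (Suc d) * t ^ d"
proof -
  have "(\<Sum>i<Suc d. t ^ i) \<le> (\<Sum>i<Suc d. t ^ d)"
    using assms by (intro sum_mono) (auto intro: power_increasing)
  then show ?thesis by (simp add: geom_sum_def)
qed

text \<open>
  The value \<open>(t\<^sup>d - 1) / (t\<^sup>d - t)\<close> with the common factor \<open>t - 1\<close> cancelled, which makes it
  meaningful at \<open>t = 1\<close>.
\<close>

definition u_param :: "nat \<Rightarrow> real \<Rightarrow> real" where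
  "u_param d t = 1 + 1 / (t * geom_sum (d - 1) t)"

definition lambda_param :: "nat \<Rightarrow> nat \<Rightarrow> real \<Rightarrow> real" where
  "lambda_param k m t =
     (let u = u_param (k - 2 * m) t in (u - 1) * u ^ m * (t * u) ^ (k - m))"

text \<open>
  With \<open>v = t u\<close> this is the balance \<open>(v - 1) / v\<^sup>d = (u - 1) / u\<^sup>d\<close>, by which the equation for \<open>l\<close>
  follows from the one for \<open>h\<close>.
\<close>

lemma u_param_balance:
  assumes "d \<ge> 2" and "t > 0"
  shows "t * u_param d t - 1 = t ^ d * (u_param d t - 1)"
proof -
  obtain e where d: "d = Suc e" and "e > 0" using assms(1) by (cases d) auto
  have pos: "geom_sum e t > 0" using geom_sum_ge_1[of e t] \<open>e > 0\<close> assms(2) by simp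
  have u1: "u_param d t - 1 = 1 / (t * geom_sum e t)" by (simp add: u_param_def d)
  have "t * u_param d t - 1 = (1 + t * geom_sum e t - geom_sum e t) / geom_sum e t"
    using pos assms(2) by (simp add: u_param_def d field_simps)
  also have "1 + t * geom_sum e t - geom_sum e t = t ^ e"
    using geom_sum_Suc[of e t] geom_sum_Suc_shift[of e t] by simp
  also have "t ^ e / geom_sum e t = t ^ d * (u_param d t - 1)"
    unfolding u1 using assms(2) by (simp add: d)
  finally show ?thesis .
qed

lemma lambda_param_at_1:
  assumes "2 * m + 2 \<le> k"
  shows "lambda_param k m 1 = lambda_cr k m"
proof -
  define d where "d = k - 2 * m"
  have d: "real k - 2 * real m = real d" and "d \<ge> 2"
    using assms by (auto simp: d_def of_nat_diff)
  have u: "u_param d 1 = real d / (real d - 1)"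
    using \<open>d \<ge> 2\<close> by (simp add: u_param_def geom_sum_def of_nat_diff field_simps)
  have u1: "u_param d 1 - 1 = 1 / (real d - 1)"
    using \<open>d \<ge> 2\<close> by (simp add: u_param_def geom_sum_def of_nat_diff field_simps)
  have "lambda_param k m 1 = (u_param d 1 - 1) * (u_param d 1 ^ m * u_param d 1 ^ (k - m))"
    by (simp add: lambda_param_def Let_def d_def)
  also have "u_param d 1 ^ m * u_param d 1 ^ (k - m) = u_param d 1 ^ k"
    using assms by (simp flip: power_add)
  finally have "lambda_param k m 1 = 1 / (real d - 1) * (real d / (real d - 1)) ^ k"
    by (simp only: u1) (simp only: u)
  then show ?thesis by (simp add: lambda_cr_def d)
qed

text \<open>
  As \<open>u \<ge> 1\<close> and \<open>u - 1\<close> decays only like \<open>t\<^bsup>-(d-1)\<^esup>\<close>, the factor \<open>(t u)\<^bsup>k-m\<^esup>\<close> wins: the difference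
  of the exponents is \<open>m + 1\<close>.
\<close>

lemma lambda_param_lower:
  assumes "2 * m + 2 \<le> k" and "t \<ge> 1"
  shows "lambda_param k m t \<ge> t / (real k - 2 * real m - 1)"
proof -
  define e where "e = k - 2 * m - 2"
  define u where "u = u_param (k - 2 * m) t"
  have k: "k = 2 * m + 2 + e" using assms(1) by (simp add: e_def)
  have km: "k - 2 * m - 1 = Suc e" "k - m = (m + 1) + Suc e" by (simp_all add: k)
  have gpos: "geom_sum (Suc e) t > 0" using geom_sum_ge_1[of "Suc e" t] assms(2) by simp
  have u1: "u - 1 = 1 / (t * geom_sum (Suc e) t)" unfolding u_def u_param_def km by simp
  have "u - 1 \<ge> 0" unfolding u1 using gpos assms(2) by simp
  then have "u \<ge> 1" by simp
  have "t * geom_sum (Suc e) t \<le> t * (real (Suc e) * t ^ e)"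
    using geom_sum_le[OF assms(2), of e] assms(2) by (intro mult_left_mono) simp_all
  then have "t * geom_sum (Suc e) t \<le> real (Suc e) * t ^ Suc e" by (simp only: power_Suc ac_simps)
  then have "1 / (real (Suc e) * t ^ Suc e) \<le> u - 1"
    unfolding u1 using gpos assms(2) by (intro divide_left_mono mult_pos_pos) auto
  moreover have "1 \<le> u ^ m" using \<open>u \<ge> 1\<close> by simp
  moreover have "t * t ^ Suc e \<le> (t * u) ^ (k - m)"
  proof -
    have "t * t ^ Suc e \<le> t ^ (m + 1) * t ^ Suc e"
      using assms(2) by (intro mult_right_mono) (auto simp: mult_le_cancel_left1)
    also have "\<dots> = t ^ (k - m)" by (simp add: km(2) power_add)
    also have "\<dots> \<le> (t * u) ^ (k - m)"
      using assms(2) \<open>u \<ge> 1\<close> by (intro power_mono) (auto simp: mult_le_cancel_left1)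
    finally show ?thesis .
  qed
  ultimately have
    "1 / (real (Suc e) * t ^ Suc e) * 1 * (t * t ^ Suc e) \<le> (u - 1) * u ^ m * (t * u) ^ (k - m)"
    using assms(2) \<open>u \<ge> 1\<close> by (intro mult_mono mult_nonneg_nonneg) auto
  moreover have "1 / (real (Suc e) * t ^ Suc e) * 1 * (t * t ^ Suc e) = t / real (Suc e)"
    using assms(2) by simp
  moreover have "real k - 2 * real m - 1 = real (Suc e)" by (simp add: k)
  ultimately show ?thesis by (simp add: lambda_param_def u_def Let_def)
qed

lemma lambda_param_surj:
  assumes "2 * m + 2 \<le> k" and "lam > lambda_cr k m"
  shows "\<exists>t>1. lambda_param k m t = lam"
proof -
  define D where "D = real k - 2 * real m - 1"
  have "D \<ge> 1" using assms(1) by (simp add: D_def)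
  have "lambda_cr k m > 0" using \<open>D \<ge> 1\<close> by (simp add: lambda_cr_def D_def)
  then have "lam > 0" using assms(2) by simp
  \<comment> \<open>the lower bound \<open>t / D\<close> exceeds \<open>lam\<close> at this point\<close>
  define T where "T = 1 + lam * D"
  have "T \<ge> 1" using \<open>lam > 0\<close> \<open>D \<ge> 1\<close> by (simp add: T_def)
  have "lam \<le> T / D" using \<open>D \<ge> 1\<close> by (simp add: T_def field_simps)
  then have hi: "lam \<le> lambda_param k m T"
    using lambda_param_lower[OF assms(1) \<open>T \<ge> 1\<close>] by (simp add: D_def)
  have lo: "lambda_param k m 1 < lam" using lambda_param_at_1[OF assms(1)] assms(2) by simp
  have nz: "t * geom_sum (k - 2 * m - 1) t \<noteq> 0" if "t \<in> {1..T}" for t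
    using that geom_sum_ge_1[of "k - 2 * m - 1" t] assms(1) by auto
  have "continuous_on {1..T} (lambda_param k m)"
    unfolding lambda_param_def Let_def u_param_def
    using nz by (intro continuous_intros) (auto simp: geom_sum_def intro!: continuous_intros)
  then obtain t where "t \<ge> 1" "lambda_param k m t = lam"
    using IVT'[of "lambda_param k m" 1 lam T] lo hi \<open>T \<ge> 1\<close> by auto
  moreover have "t \<noteq> 1" using lo calculation by auto
  ultimately show ?thesis by (intro exI[of _ t]) auto
qed

lemma hl_solution_swap: "hl_solution k lam m m h l \<longleftrightarrow> hl_solution k lam m m l h"
  by (auto simp: hl_solution_def)

lemma hl_solution_asymmetric:
  assumes "2 * m + 2 \<le> k" and "lam > lambda_cr k m" and "lam > 0"
  shows "\<exists>h l. h \<noteq> l \<and> hl_solution k lam m m h l"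
proof -
  obtain t where t: "t > 1" "lambda_param k m t = lam"
    using lambda_param_surj[OF assms(1,2)] by blast
  define d where "d = k - 2 * m"
  define u where "u = u_param d t"
  define h where "h = (u - 1) / lam"
  define l where "l = (t * u - 1) / lam"
  have "d \<ge> 2" using assms(1) by (simp add: d_def)
  have "u > 1" using geom_sum_ge_1[of "d - 1" t] t(1) \<open>d \<ge> 2\<close> by (simp add: u_def u_param_def)
  have "t * u > u" using t(1) \<open>u > 1\<close> by simp
  have h: "1 + lam * h = u" and l: "1 + lam * l = t * u"
    using assms(3) by (simp_all add: h_def l_def)
  have lam: "(u - 1) * u ^ m * (t * u) ^ (k - m) = lam"
    using t(2) by (simp add: lambda_param_def Let_def u_def d_def)
  have bal: "t * u - 1 = t ^ d * (u - 1)"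
    using u_param_balance[OF \<open>d \<ge> 2\<close>, of t] t(1) by (simp add: u_def)
  have km: "k - m = m + d" using assms(1) by (simp add: d_def)
  have lam': "(t * u - 1) * (t * u) ^ m * u ^ (k - m) = lam"
    using lam unfolding bal km by (simp add: power_add power_mult_distrib algebra_simps)
  have "h = 1 / (u ^ m * (t * u) ^ (k - m))"
    using lam \<open>u > 1\<close> t(1) assms(3) by (simp add: h_def field_simps)
  moreover have "l = 1 / ((t * u) ^ m * u ^ (k - m))"
    using lam' \<open>u > 1\<close> t(1) assms(3) by (simp add: l_def field_simps)
  moreover have "h > 0" "h \<noteq> l"
    using \<open>u > 1\<close> \<open>t * u > u\<close> assms(3) by (auto simp: h_def l_def)
  moreover have "l > 0"
    unfolding l_def using \<open>u > 1\<close> \<open>t * u > u\<close> assms(3) by (intro divide_pos_pos) linarith+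
  ultimately show ?thesis
    unfolding hl_solution_def using h l by (intro exI[of _ h] exI[of _ l]) simp
qed

lemma hl_solution_symmetric:
  assumes "m \<le> k" and "lam > 0"
  shows "\<exists>c. hl_solution k lam m m c c"
proof -
  have "\<exists>c\<ge>0. c \<le> 1 \<and> c * (1 + lam * c) ^ k = (1::real)"
    using assms(2) by (intro IVT') (auto intro!: continuous_intros)
  then obtain c where c: "c \<ge> 0" "c * (1 + lam * c) ^ k = 1" by blast
  have "c > 0" using c by (cases "c = 0") auto
  have "(1 + lam * c) ^ m * (1 + lam * c) ^ (k - m) = (1 + lam * c) ^ k"
    using assms(1) by (simp flip: power_add)
  moreover have "c = 1 / (1 + lam * c) ^ k"
    using c(2) by (metis mult_zero_right nonzero_mult_div_cancel_right zero_neq_one)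
  ultimately show ?thesis
    using \<open>c > 0\<close> by (intro exI[of _ c]) (simp add: hl_solution_def)
qed

text \<open>
  Equating the two expressions for \<open>h\<close> leaves \<open>(1 + \<lambda>l)\<^bsup>k-m\<^esup> = (1 + \<lambda>h)\<^bsup>k-m\<^esup>\<close>.
\<close>

lemma hl_solution_with_constant_value:
  assumes "hl_solution k lam m m h l" and "m < k" and "lam > 0"
    and "h = inverse (1 + lam * h) ^ k"
  shows "h = l"
proof -
  define u v where "u = 1 + lam * h" and "v = 1 + lam * l"
  have pos: "h > 0" "l > 0" and eq: "h = 1 / (u ^ m * v ^ (k - m))"
    using assms(1) by (simp_all add: hl_solution_def u_def v_def)
  have "u > 0" "v > 0" using pos assms(3) by (simp_all add: u_def v_def add_pos_pos)
  have "u ^ m * v ^ (k - m) = u ^ k"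
  proof -
    have "h = 1 / u ^ k" using assms(4) by (simp add: u_def power_one_over inverse_eq_divide)
    then have "1 / u ^ k = 1 / (u ^ m * v ^ (k - m))" using eq by metis
    then show ?thesis by (metis inverse_eq_divide inverse_eq_iff_eq)
  qed
  also have "\<dots> = u ^ m * u ^ (k - m)" using assms(2) by (simp flip: power_add)
  finally have "v ^ (k - m) = u ^ (k - m)" using \<open>u > 0\<close> by simp
  then have "v = u" using \<open>u > 0\<close> \<open>v > 0\<close> assms(2) by (simp add: power_eq_iff_eq_base)
  then show ?thesis using assms(3) by (simp add: u_def v_def)
qed

lemma hl_boundary_law:
  assumes "arrangement k m r a" and "hl_solution k lam m r h l"
  shows "boundary_law k lam (hl_function a h l)"
  unfolding boundary_law_def
proof (intro ballI conjI)
  fix x assume x: "x \<in> verts k"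
  show "hl_function a h l x > 0" using assms(2) by (simp add: hl_function_def hl_solution_def)
  have fin: "finite (succs k x)" by (simp add: succs_def)
  have "(\<Prod>y\<in>succs k x. inverse (1 + lam * hl_function a h l y)) =
      (\<Prod>y\<in>succs k x. if a y then inverse (1 + lam * h) else inverse (1 + lam * l))"
    by (intro prod.cong) (auto simp: hl_function_def)
  also have "\<dots> = inverse (1 + lam * h) ^ card {y \<in> succs k x. a y} *
      inverse (1 + lam * l) ^ card {y \<in> succs k x. \<not> a y}"
  proof -
    have "succs k x \<inter> {y. a y} = {y \<in> succs k x. a y}"
      and "succs k x \<inter> - {y. a y} = {y \<in> succs k x. \<not> a y}" by auto
    then show ?thesis by (simp add: prod.If_cases[OF fin])
  qed
  also have "\<dots> = hl_function a h l x"
  proof (cases "a x")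
    case True
    moreover have "h = inverse (1 + lam * h) ^ m * inverse (1 + lam * l) ^ (k - m)"
      using assms(2) by (simp add: hl_solution_def power_inverse inverse_eq_divide power_one_over)
    ultimately show ?thesis using assms(1) x by (simp add: arrangement_def hl_function_def)
  next
    case False
    moreover have "l = inverse (1 + lam * h) ^ (k - r) * inverse (1 + lam * l) ^ r"
      using assms(2)
      by (simp add: hl_solution_def power_inverse inverse_eq_divide power_one_over mult.commute)
    ultimately show ?thesis using assms(1) x by (simp add: arrangement_def hl_function_def)
  qed
  finally show "hl_function a h l x =
      (\<Prod>y\<in>succs k x. inverse (1 + lam * hl_function a h l y))" by simp
qed

section \<open>Balls and spheres of the half-tree\<close>

lemma ball_verts_altdef: "ball_verts k n = {x \<in> verts k. length x \<le> n}"
  by (auto simp: ball_verts_def sphere_verts_def)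

lemma finite_ball_verts: "finite (ball_verts k n)"
  using finite_lists_length_le[of "{..<k}" n]
  by (simp add: ball_verts_altdef verts_def lists_eq_set conj_commute Collect_conj_eq)

lemma finite_sphere_verts: "finite (sphere_verts k n)"
  using finite_ball_verts by (rule finite_subset[rotated]) (auto simp: ball_verts_def)

lemma Cons_in_verts: "i # x \<in> verts k \<longleftrightarrow> i < k \<and> x \<in> verts k"
  by (simp add: verts_def)

lemma ball_verts_Suc: "ball_verts k (Suc n) = ball_verts k n \<union> sphere_verts k (Suc n)"
  by (auto simp: ball_verts_def le_Suc_eq)

lemma ball_sphere_disjoint: "ball_verts k n \<inter> sphere_verts k (Suc n) = {}"
  by (auto simp: ball_verts_def sphere_verts_def)

lemma sphere_verts_Suc: "sphere_verts k (Suc n) = (\<Union>x\<in>sphere_verts k n. succs k x)"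
proof (rule set_eqI)
  fix y show "y \<in> sphere_verts k (Suc n) \<longleftrightarrow> y \<in> (\<Union>x\<in>sphere_verts k n. succs k x)"
    by (cases y) (auto simp: sphere_verts_def succs_def Cons_in_verts)
qed

lemma prod_sphere_Suc:
  "(\<Prod>y\<in>sphere_verts k (Suc n). f y) = (\<Prod>x\<in>sphere_verts k n. \<Prod>y\<in>succs k x. (f y :: real))"
  unfolding sphere_verts_Suc
  by (rule prod.UNION_disjoint) (auto simp: finite_sphere_verts succs_def)

lemma prod_ball_Suc:
  "(\<Prod>y\<in>ball_verts k (Suc n). f y) =
     (\<Prod>x\<in>ball_verts k n. f x) * (\<Prod>y\<in>sphere_verts k (Suc n). (f y :: real))"
  unfolding ball_verts_Suc
  by (rule prod.union_disjoint) (auto simp: finite_ball_verts finite_sphere_verts ball_sphere_disjoint)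

section \<open>Configurations from independent coins\<close>

text \<open>
  The sites that the configuration does not force to be empty from above; only their coins matter.
\<close>

definition free_site :: "(vertex \<Rightarrow> nat) \<Rightarrow> vertex \<Rightarrow> bool" where
  "free_site s x \<longleftrightarrow> x = [] \<or> s (tl x) \<noteq> 1"

primrec grow :: "(vertex \<Rightarrow> bool) \<Rightarrow> vertex \<Rightarrow> nat" where
  "grow \<omega> [] = of_bool (\<omega> [])"
| "grow \<omega> (i # x) = (if grow \<omega> x = 1 then 0 else of_bool (\<omega> (i # x)))"

lemma grow_01: "grow \<omega> x \<in> {0, 1}"
  by (cases x) auto

lemma grow_admissible: "restrict (grow \<omega>) A \<in> admissible k A"
proof -
  have succ: "grow \<omega> x * grow \<omega> y = 0" if "y \<in> succs k x" for x y
    using that grow_01[of \<omega> x] by (auto simp: succs_def)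
  have "grow \<omega> x * grow \<omega> y = 0" if "neighbours k x y" for x y
    using that succ[of y x] succ[of x y] unfolding neighbours_def by (metis mult.commute)
  then show ?thesis using grow_01 unfolding admissible_def by auto
qed

lemma admissible_restrict:
  assumes "s \<in> admissible k B" and "A \<subseteq> B"
  shows "restrict s A \<in> admissible k A"
proof -
  have "s x \<in> {0, 1}" if "x \<in> A" for x
    using assms that by (auto simp: admissible_def)
  moreover have "s x * s y = 0" if "x \<in> A" "y \<in> A" "neighbours k x y" for x y
    using assms that unfolding admissible_def by blast
  ultimately show ?thesis unfolding admissible_def by auto
qed

lemma finite_admissible: "finite A \<Longrightarrow> finite (admissible k A)"
  unfolding admissible_def by (rule finite_subset[of _ "A \<rightarrow>\<^sub>E {0,1}"]) (auto intro: finite_PiE)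

lemma nonfree_zero:
  assumes "s \<in> admissible k (ball_verts k n)" and "x \<in> ball_verts k n" and "\<not> free_site s x"
  shows "s x = 0"
proof -
  obtain i y where x: "x = i # y" and y: "s y = 1"
    using assms(3) by (cases x) (auto simp: free_site_def)
  have "y \<in> ball_verts k n" "neighbours k y x"
    using assms(2) by (auto simp: ball_verts_altdef x Cons_in_verts neighbours_def succs_def)
  then have "s y * s x = 0" using assms(1,2) by (auto simp: admissible_def)
  then show ?thesis using y by simp
qed

text \<open>
  This turns a cylinder event of the dependent configuration into one of the independent coins, at the
  price that the set of coins involved varies with \<open>s\<close>.
\<close>

lemma grow_eq_iff:
  assumes s: "s \<in> admissible k (ball_verts k n)"
  shows "(\<forall>x\<in>ball_verts k n. grow \<omega> x = s x) \<longleftrightarrow>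
         (\<forall>x\<in>ball_verts k n. free_site s x \<longrightarrow> \<omega> x = (s x = 1))"
    (is "?L \<longleftrightarrow> ?R")
proof
  assume L: ?L
  show ?R
  proof (intro ballI impI)
    fix x assume x: "x \<in> ball_verts k n" and f: "free_site s x"
    have "grow \<omega> x = of_bool (\<omega> x)"
    proof (cases x)
      case (Cons i y)
      then have "y \<in> ball_verts k n" using x by (auto simp: ball_verts_altdef Cons_in_verts)
      then show ?thesis using L f by (auto simp: free_site_def Cons)
    qed simp
    then show "\<omega> x = (s x = 1)" using L x by (metis of_bool_eq_1_iff)
  qed
next
  assume R: ?R
  have s01: "s x \<in> {0, 1}" if "x \<in> ball_verts k n" for x
    using s that by (auto simp: admissible_def)
  have "x \<in> ball_verts k n \<Longrightarrow> grow \<omega> x = s x" for x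
  proof (induction x)
    case Nil
    then show ?case using R s01[OF Nil] by (auto simp: free_site_def)
  next
    case (Cons i y)
    then have "y \<in> ball_verts k n" by (auto simp: ball_verts_altdef Cons_in_verts)
    then have y: "grow \<omega> y = s y" by (rule Cons.IH)
    show ?case
    proof (cases "s y = 1")
      case True
      then show ?thesis using nonfree_zero[OF s Cons.prems] y by (simp add: free_site_def)
    next
      case False
      then show ?thesis
        using R Cons.prems s01[OF Cons.prems] y by (auto simp: free_site_def)
    qed
  qed
  then show ?L by blast
qed

section \<open>The coin model has the prescribed marginals\<close>

definition coin_bias :: "real \<Rightarrow> (vertex \<Rightarrow> real) \<Rightarrow> vertex \<Rightarrow> real" where
  "coin_bias lam z x = lam * z x / (1 + lam * z x)"

text \<open>
  The coins of the non-free sites contribute no factor \<open>q\<close>. By the boundary law, the missing factors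
  of the successors of an occupied \<open>x\<close> multiply to \<open>z\<^sub>x\<close>, so they cancel the factors \<open>z\<^sub>x\<close> of all
  occupied sites except those on the outermost sphere, whose successors lie outside the ball.
\<close>

lemma free_site_prod:
  fixes z :: "vertex \<Rightarrow> real"
  assumes bl: "boundary_law k lam z"
  defines "\<zeta> \<equiv> \<lambda>s x. if s x = (1::nat) then z x else 1"
    and "q \<equiv> \<lambda>x. inverse (1 + lam * z x)"
  shows "(\<Prod>x\<in>ball_verts k n. \<zeta> s x) * (\<Prod>x\<in>ball_verts k n. if free_site s x then q x else 1) =
         (\<Prod>x\<in>sphere_verts k n. \<zeta> s x) * (\<Prod>x\<in>ball_verts k n. q x)"
proof (induction n)
  case 0
  have "ball_verts k 0 = {[]}" "sphere_verts k 0 = {[]}"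
    by (auto simp: ball_verts_def sphere_verts_def verts_def)
  then show ?case by (simp add: free_site_def)
next
  case (Suc n)
  let ?F = "\<lambda>x. if free_site s x then q x else 1"
  have site: "\<zeta> s x * (\<Prod>y\<in>succs k x. ?F y) = (\<Prod>y\<in>succs k x. q y)"
    if "x \<in> sphere_verts k n" for x
  proof -
    have "(\<Prod>y\<in>succs k x. ?F y) = (\<Prod>y\<in>succs k x. if s x = 1 then 1 else q y)"
      by (intro prod.cong) (auto simp: succs_def free_site_def)
    moreover have "z x = (\<Prod>y\<in>succs k x. q y)"
      using bl that unfolding boundary_law_def sphere_verts_def q_def by blast
    ultimately show ?thesis by (simp add: \<zeta>_def)
  qed
  have shell: "(\<Prod>x\<in>sphere_verts k n. \<zeta> s x) * (\<Prod>x\<in>sphere_verts k (Suc n). ?F x) =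
      (\<Prod>x\<in>sphere_verts k (Suc n). q x)"
    unfolding prod_sphere_Suc prod.distrib[symmetric] by (intro prod.cong site refl)
  have "(\<Prod>x\<in>ball_verts k (Suc n). \<zeta> s x) * (\<Prod>x\<in>ball_verts k (Suc n). ?F x) =
      ((\<Prod>x\<in>ball_verts k n. \<zeta> s x) * (\<Prod>x\<in>ball_verts k n. ?F x)) *
      (\<Prod>x\<in>sphere_verts k (Suc n). \<zeta> s x) * (\<Prod>x\<in>sphere_verts k (Suc n). ?F x)"
    by (simp add: prod_ball_Suc)
  also have "\<dots> = (\<Prod>x\<in>sphere_verts k (Suc n). \<zeta> s x) * (\<Prod>x\<in>ball_verts k n. q x) *
      ((\<Prod>x\<in>sphere_verts k n. \<zeta> s x) * (\<Prod>x\<in>sphere_verts k (Suc n). ?F x))"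
    unfolding Suc.IH by (simp only: ac_simps)
  finally show ?case unfolding shell by (simp add: prod_ball_Suc[of q] mult.assoc)
qed

text \<open>
  The second factor on the right does not depend on \<open>s\<close>, so it must be the inverse of the normalizing
  constant.
\<close>

lemma coin_prob_eq_weight:
  assumes bl: "boundary_law k lam z" and lam: "lam > 0"
    and s: "s \<in> admissible k (ball_verts k n)"
  shows "(\<Prod>x\<in>{x \<in> ball_verts k n. free_site s x}.
            if s x = 1 then coin_bias lam z x else 1 - coin_bias lam z x) =
         hc_weight k lam z n s * (\<Prod>x\<in>ball_verts k n. inverse (1 + lam * z x))"
proof -
  let ?q = "\<lambda>x. inverse (1 + lam * z x)"
  let ?F = "\<lambda>x. if free_site s x then ?q x else 1"
  have pos: "1 + lam * z x > 0" if "x \<in> ball_verts k n" for x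
    using bl lam that by (auto simp: boundary_law_def ball_verts_altdef intro!: add_pos_pos)
  have "(\<Prod>x\<in>{x \<in> ball_verts k n. free_site s x}.
            if s x = 1 then coin_bias lam z x else 1 - coin_bias lam z x) =
      (\<Prod>x\<in>ball_verts k n. if free_site s x then
            (if s x = 1 then coin_bias lam z x else 1 - coin_bias lam z x) else 1)"
    by (rule prod.inter_filter[OF finite_ball_verts])
  also have "\<dots> = (\<Prod>x\<in>ball_verts k n.
      (if s x = 1 then lam else 1) * ((if s x = 1 then z x else 1) * ?F x))"
  proof (intro prod.cong refl)
    fix x assume x: "x \<in> ball_verts k n"
    show "(if free_site s x then
            (if s x = 1 then coin_bias lam z x else 1 - coin_bias lam z x) else 1) =
        (if s x = 1 then lam else 1) * ((if s x = 1 then z x else 1) * ?F x)"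
    proof (cases "free_site s x")
      case True
      have "1 - coin_bias lam z x = ?q x"
        using pos[OF x] by (simp add: coin_bias_def field_simps)
      then show ?thesis using True by (simp add: coin_bias_def divide_inverse)
    qed (use nonfree_zero[OF s x] in simp)
  qed
  also have "\<dots> = (\<Prod>x\<in>ball_verts k n. if s x = 1 then lam else 1) *
      ((\<Prod>x\<in>ball_verts k n. if s x = 1 then z x else 1) * (\<Prod>x\<in>ball_verts k n. ?F x))"
    by (simp only: prod.distrib)
  also have "(\<Prod>x\<in>ball_verts k n. if s x = 1 then lam else 1) = lam ^ occupied k n s"
    by (simp add: occupied_def finite_ball_verts flip: prod.inter_filter)
  finally show ?thesis
    unfolding free_site_prod[OF bl] hc_weight_def by (simp only: mult.assoc)
qed

definition coin_space :: "nat \<Rightarrow> real \<Rightarrow> (vertex \<Rightarrow> real) \<Rightarrow> (vertex \<Rightarrow> bool) measure" where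
  "coin_space k lam z = Pi\<^sub>M (verts k) (\<lambda>x. measure_pmf (bernoulli_pmf (coin_bias lam z x)))"

lemma prob_space_coin_space: "prob_space (coin_space k lam z)"
  unfolding coin_space_def by (intro prob_space_PiM measure_pmf.prob_space_axioms)

lemma coin_measurable:
  "f \<in> measurable M (measure_pmf p) \<Longrightarrow> f \<in> measurable M (count_space UNIV)"
  using measurable_cong_sets[OF refl sets_measure_pmf_count_space] by blast

lemma measurable_grow:
  "x \<in> verts k \<Longrightarrow> (\<lambda>\<omega>. grow \<omega> x) \<in> measurable (coin_space k lam z) (count_space {0, 1})"
proof (induction x)
  case Nil
  have [measurable]: "(\<lambda>\<omega>. \<omega> []) \<in> measurable (coin_space k lam z) (count_space UNIV)"
    unfolding coin_space_def
    by (rule measurable_component_singleton[OF Nil, THEN coin_measurable])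
  show ?case by (simp add: of_bool_def)
next
  case (Cons i x)
  have [measurable]: "(\<lambda>\<omega>. \<omega> (i # x)) \<in> measurable (coin_space k lam z) (count_space UNIV)"
    unfolding coin_space_def
    by (rule measurable_component_singleton[OF Cons.prems, THEN coin_measurable])
  have [measurable]: "(\<lambda>\<omega>. grow \<omega> x) \<in> measurable (coin_space k lam z) (count_space {0, 1})"
    using Cons by (simp add: Cons_in_verts)
  show ?case by (simp add: of_bool_def)
qed

lemma measurable_grow_config:
  "(\<lambda>\<omega>. restrict (grow \<omega>) (verts k)) \<in> measurable (coin_space k lam z) (config_space k)"
  unfolding config_space_def
  by (intro measurable_restrict_space2 measurable_restrict measurable_grow)
     (auto simp: grow_admissible)

lemma measure_coin_cylinder:
  assumes "boundary_law k lam z" and "lam > 0" and "finite J" and "J \<subseteq> verts k"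
  shows "measure (coin_space k lam z) {\<omega> \<in> space (coin_space k lam z). \<forall>x\<in>J. \<omega> x = b x} =
         (\<Prod>x\<in>J. if b x then coin_bias lam z x else 1 - coin_bias lam z x)"
proof -
  interpret product_prob_space "\<lambda>x. measure_pmf (bernoulli_pmf (coin_bias lam z x))" "verts k"
    by unfold_locales
  have "{\<omega> \<in> space (coin_space k lam z). \<forall>x\<in>J. \<omega> x = b x} = emb (verts k) J (\<Pi>\<^sub>E x\<in>J. {b x})"
    using assms(4) by (auto simp: coin_space_def prod_emb_def space_PiM Pi_iff)
  also have "measure (coin_space k lam z) \<dots> =
      (\<Prod>x\<in>J. measure (measure_pmf (bernoulli_pmf (coin_bias lam z x))) {b x})"
    unfolding coin_space_def by (rule measure_PiM_emb) (use assms in auto)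
  also have "\<dots> = (\<Prod>x\<in>J. if b x then coin_bias lam z x else 1 - coin_bias lam z x)"
  proof (intro prod.cong refl)
    fix x assume "x \<in> J"
    then have "z x > 0" using assms by (auto simp: boundary_law_def)
    then have "coin_bias lam z x \<in> {0..1}" using assms(2)
      by (auto simp: coin_bias_def divide_simps add_pos_pos)
    then show "measure (measure_pmf (bernoulli_pmf (coin_bias lam z x))) {b x} =
        (if b x then coin_bias lam z x else 1 - coin_bias lam z x)"
      by (cases "b x") (simp_all add: measure_pmf_single)
  qed
  finally show ?thesis .
qed

lemma restrict_eq_admissible_iff:
  assumes "s \<in> admissible k A"
  shows "restrict \<omega> A = s \<longleftrightarrow> (\<forall>x\<in>A. \<omega> x = s x)"
  using assms by (fastforce simp: admissible_def PiE_def extensional_def fun_eq_iff)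

lemma cylinder_in_sets:
  assumes "s \<in> admissible k (ball_verts k n)"
  shows "{\<omega> \<in> space (config_space k). restrict \<omega> (ball_verts k n) = s} \<in> sets (config_space k)"
proof -
  have [measurable]: "(\<lambda>\<omega>. \<omega> x) \<in> measurable (config_space k) (count_space {0, 1})"
    if "x \<in> ball_verts k n" for x
    using that unfolding config_space_def
    by (intro measurable_restrict_space1 measurable_component_singleton)
       (auto simp: ball_verts_altdef)
  have "{\<omega> \<in> space (config_space k). \<forall>x\<in>ball_verts k n. \<omega> x = s x} \<in> sets (config_space k)"
    by (intro sets.sets_Collect_finite_All finite_ball_verts) measurable
  then show ?thesis by (simp add: restrict_eq_admissible_iff[OF assms])
qed

lemma gibbs_measure_exists:
  assumes bl: "boundary_law k lam z" and lam: "lam > 0"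
  shows "\<exists>M. gibbs_measure k lam z M"
proof -
  let ?P = "coin_space k lam z"
  let ?g = "\<lambda>\<omega>. restrict (grow \<omega>) (verts k)"
  define M where "M = distr ?P (config_space k) ?g"
  define C where "C = (\<lambda>n. \<Prod>x\<in>ball_verts k n. inverse (1 + lam * z x))"
  define E where "E = (\<lambda>n s. {\<omega> \<in> space M. restrict \<omega> (ball_verts k n) = s})"
  interpret P: prob_space ?P by (rule prob_space_coin_space)
  interpret M: prob_space M
    unfolding M_def by (rule P.prob_space_distr[OF measurable_grow_config])
  have spM: "space M = space (config_space k)" and setsM: "sets M = sets (config_space k)"
    by (simp_all add: M_def)
  have sub: "ball_verts k n \<subseteq> verts k" for n by (auto simp: ball_verts_altdef)
  have prob: "measure M (E n s) = hc_weight k lam z n s * C n"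
    if s: "s \<in> admissible k (ball_verts k n)" for n s
  proof -
    let ?J = "{x \<in> ball_verts k n. free_site s x}"
    have "measure M (E n s) = measure ?P (?g -` E n s \<inter> space ?P)"
      unfolding M_def E_def space_distr
      by (rule measure_distr[OF measurable_grow_config cylinder_in_sets[OF s]])
    also have "?g -` E n s \<inter> space ?P = {\<omega> \<in> space ?P. \<forall>x\<in>?J. \<omega> x = (s x = 1)}"
    proof -
      have "?g \<omega> \<in> E n s \<longleftrightarrow> (\<forall>x\<in>?J. \<omega> x = (s x = 1))" if "\<omega> \<in> space ?P" for \<omega>
      proof -
        have "?g \<omega> \<in> space M"
          using measurable_space[OF measurable_grow_config that] by (simp add: spM)
        moreover have "restrict (?g \<omega>) (ball_verts k n) = restrict (grow \<omega>) (ball_verts k n)"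
          using sub[of n] by (simp add: Int_absorb1)
        ultimately have "?g \<omega> \<in> E n s \<longleftrightarrow> restrict (grow \<omega>) (ball_verts k n) = s"
          by (simp add: E_def)
        then show ?thesis
          unfolding restrict_eq_admissible_iff[OF s] grow_eq_iff[OF s] by blast
      qed
      then show ?thesis by auto
    qed
    also have "measure ?P \<dots> = (\<Prod>x\<in>?J. if s x = 1 then coin_bias lam z x else 1 - coin_bias lam z x)"
      using sub[of n] by (intro measure_coin_cylinder bl lam) (auto simp: finite_ball_verts)
    also have "\<dots> = hc_weight k lam z n s * C n"
      unfolding C_def by (rule coin_prob_eq_weight[OF bl lam s])
    finally show ?thesis .
  qed
  \<comment> \<open>the cylinder events partition the space, which identifies the constant \<open>C n\<close>\<close>
  have "measure M (E n s) = hc_marginal k lam z n s"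
    if s: "s \<in> admissible k (ball_verts k n)" for n s
  proof -
    let ?A = "admissible k (ball_verts k n)"
    have "restrict \<omega> (ball_verts k n) \<in> ?A" if "\<omega> \<in> space M" for \<omega>
    proof -
      have "\<omega> \<in> admissible k (verts k)"
        using that by (simp add: spM config_space_def space_restrict_space)
      then show ?thesis using sub[of n] by (rule admissible_restrict)
    qed
    then have "space M = (\<Union>s\<in>?A. E n s)" by (auto simp: E_def)
    then have "1 = measure M (\<Union>s\<in>?A. E n s)" using M.prob_space by simp
    also have "\<dots> = (\<Sum>s\<in>?A. measure M (E n s))"
    proof (rule M.finite_measure_finite_Union)
      show "finite ?A" by (intro finite_admissible finite_ball_verts)
      show "E n ` ?A \<subseteq> sets M" using cylinder_in_sets by (auto simp: E_def spM setsM)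
      show "disjoint_family_on (E n) ?A" by (auto simp: disjoint_family_on_def E_def)
    qed
    also have "\<dots> = (\<Sum>s\<in>?A. hc_weight k lam z n s) * C n"
      using prob by (simp add: sum_distrib_right)
    finally have "(\<Sum>s\<in>?A. hc_weight k lam z n s) * C n = 1" by simp
    then have "C n = 1 / (\<Sum>s\<in>?A. hc_weight k lam z n s)"
      by (metis mult_zero_left nonzero_mult_div_cancel_left zero_neq_one)
    then show ?thesis using prob[OF s] by (simp add: hc_marginal_def)
  qed
  then have "gibbs_measure k lam z M"
    unfolding gibbs_measure_def E_def using bl spM setsM M.prob_space_axioms by blast
  then show ?thesis by blast
qed

section \<open>The occupation of the root\<close>

lemma hc_normalizer_pos:
  assumes "boundary_law k lam z" and "lam > 0"
  shows "(\<Sum>\<tau>\<in>admissible k (ball_verts k n). hc_weight k lam z n \<tau>) > 0"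
proof (rule sum_pos)
  show "finite (admissible k (ball_verts k n))" by (intro finite_admissible finite_ball_verts)
  show "admissible k (ball_verts k n) \<noteq> {}"
    using grow_admissible[of _ "ball_verts k n" k] by blast
  show "hc_weight k lam z n \<tau> > 0" for \<tau>
    using assms unfolding hc_weight_def
    by (intro mult_pos_pos prod_pos) (auto simp: boundary_law_def sphere_verts_def)
qed

text \<open>
  Taking the odds of an occupied root removes the normalizing constant, which depends on \<open>z\<close>.
\<close>

lemma gibbs_measure_root:
  assumes "gibbs_measure k lam z M" and "lam > 0"
  shows "measure M {\<omega> \<in> space M. restrict \<omega> {[]} = restrict (\<lambda>_. 1) {[]}} =
         lam * z [] * measure M {\<omega> \<in> space M. restrict \<omega> {[]} = restrict (\<lambda>_. 0) {[]}}"
    and "measure M {\<omega> \<in> space M. restrict \<omega> {[]} = restrict (\<lambda>_. 0) {[]}} > 0"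
    (is "measure M (?E 0) > 0")
proof -
  have ball: "ball_verts k 0 = {[]}" and sph: "sphere_verts k 0 = {[]}"
    by (auto simp: ball_verts_def sphere_verts_def verts_def)
  have adm: "restrict (\<lambda>_. c) {[]} \<in> admissible k (ball_verts k 0)" if "c \<in> {0, 1}" for c
    using that by (auto simp: admissible_def ball neighbours_def succs_def)
  have marg: "measure M (?E c) = hc_marginal k lam z 0 (restrict (\<lambda>_. c) {[]})"
    if "c \<in> {0, 1}" for c
    using assms(1) adm[OF that] unfolding gibbs_measure_def ball[symmetric] by blast
  have weight: "hc_weight k lam z 0 (restrict (\<lambda>_. c) {[]}) = (if c = 1 then lam * z [] else 1)"
    for c by (simp add: hc_weight_def occupied_def ball sph)
  show "measure M (?E 1) = lam * z [] * measure M (?E 0)"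
    using marg weight by (simp add: hc_marginal_def)
  have "boundary_law k lam z" using assms(1) by (simp add: gibbs_measure_def)
  then show "measure M (?E 0) > 0"
    using marg weight hc_normalizer_pos[OF _ assms(2)] by (simp add: hc_marginal_def)
qed

lemma gibbs_measure_root_unique:
  assumes "gibbs_measure k lam z M" and "gibbs_measure k lam z' M" and "lam > 0"
  shows "z [] = z' []"
proof -
  have "lam * z [] = lam * z' []"
    using gibbs_measure_root[OF assms(1,3)] gibbs_measure_root[OF assms(2,3)]
    by simp
  then show ?thesis using assms(3) by simp
qed

text \<open>
  Translation invariance allows an arbitrary constant boundary law, unrelated to \<open>h\<close> and \<open>l\<close>; the
  root occupation ties its value to the one of \<open>h\<close> and \<open>l\<close> that sits at the root.
\<close>

lemma asymmetric_not_TI: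
  assumes "hl_gibbs_measure k lam m m a h l M" and "m < k" and "lam > 0" and "h \<noteq> l"
  shows "\<not> TI_gibbs_measure k lam M"
proof
  assume "TI_gibbs_measure k lam M"
  then obtain z c where z: "\<And>x. x \<in> verts k \<Longrightarrow> z x = c" and g: "gibbs_measure k lam z M"
    by (auto simp: TI_gibbs_measure_def)
  have sol: "hl_solution k lam m m h l" and g': "gibbs_measure k lam (hl_function a h l) M"
    using assms(1) by (simp_all add: hl_gibbs_measure_def)
  have root: "[] \<in> verts k" by (simp add: verts_def)
  have "z [] = (\<Prod>y\<in>succs k []. inverse (1 + lam * z y))"
    using g root by (auto simp: gibbs_measure_def boundary_law_def)
  also have "\<dots> = (\<Prod>y\<in>succs k []. inverse (1 + lam * c))"
    using z root by (intro prod.cong) (auto simp: succs_def Cons_in_verts)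
  also have "\<dots> = inverse (1 + lam * c) ^ k"
    by (simp add: succs_def card_image inj_on_def)
  finally have c: "c = inverse (1 + lam * c) ^ k" using z root by simp
  have "c = hl_function a h l []"
    using gibbs_measure_root_unique[OF g g' assms(3)] z root by simp
  then consider "c = h" | "c = l" by (metis hl_function_def)
  then show False
  proof cases
    case 1
    then show False
      using hl_solution_with_constant_value[OF sol assms(2,3)] c assms(4) by simp
  next
    case 2
    then show False
      using hl_solution_with_constant_value[of k lam m l h] sol assms(2,3,4) c
      by (simp add: hl_solution_swap)
  qed
qed

theorem theorem5:
  fixes k m r :: nat and lam :: real and a :: "vertex \<Rightarrow> bool"
  assumes "k \<ge> 2"
    and "m = r"
    and "m + r \<le> k - 2"
    and "arrangement k m r a"
    and "lam > lambda_cr k m"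
  shows "\<exists>M0 M1 M2 h0 l0 h1 l1 h2 l2.
           distinct [M0, M1, M2] \<and>
           hl_gibbs_measure k lam m r a h0 l0 M0 \<and> h0 = l0 \<and> TI_gibbs_measure k lam M0 \<and>
           hl_gibbs_measure k lam m r a h1 l1 M1 \<and> h1 \<noteq> l1 \<and> \<not> TI_gibbs_measure k lam M1 \<and>
           hl_gibbs_measure k lam m r a h2 l2 M2 \<and> h2 \<noteq> l2 \<and> \<not> TI_gibbs_measure k lam M2"
proof -
  have km: "2 * m + 2 \<le> k" "m \<le> k" "m < k" and r: "r = m" using assms(1-3) by auto
  have "lambda_cr k m > 0" using km(1) by (simp add: lambda_cr_def)
  then have lam: "lam > 0" using assms(5) by simp
  have exists: "\<exists>M. hl_gibbs_measure k lam m m a h l M" if "hl_solution k lam m m h l" for h l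
    using gibbs_measure_exists[OF hl_boundary_law lam] assms(4) that
    by (simp add: hl_gibbs_measure_def r)
  obtain c where c: "hl_solution k lam m m c c" using hl_solution_symmetric[OF km(2) lam] by blast
  obtain h l where hl: "h \<noteq> l" "hl_solution k lam m m h l"
    using hl_solution_asymmetric[OF km(1) assms(5) lam] by blast
  obtain M0 where M0: "hl_gibbs_measure k lam m m a c c M0" using exists[OF c] by blast
  obtain M1 where M1: "hl_gibbs_measure k lam m m a h l M1" using exists[OF hl(2)] by blast
  obtain M2 where M2: "hl_gibbs_measure k lam m m a l h M2"
    using exists hl(2) hl_solution_swap by blast
  have TI: "TI_gibbs_measure k lam M0"
    unfolding TI_gibbs_measure_def
    using M0 by (intro exI[of _ "hl_function a c c"] exI[of _ c])
      (simp add: hl_gibbs_measure_def hl_function_def)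
  have nTI: "\<not> TI_gibbs_measure k lam M1" "\<not> TI_gibbs_measure k lam M2"
    using asymmetric_not_TI[OF M1 km(3) lam] asymmetric_not_TI[OF M2 km(3) lam] hl(1) by auto
  have "M1 \<noteq> M2"
    using gibbs_measure_root_unique[OF _ _ lam, of k "hl_function a h l" M1 "hl_function a l h"]
      M1 M2 hl(1) by (auto simp: hl_gibbs_measure_def hl_function_def split: if_splits)
  then have "distinct [M0, M1, M2]" using TI nTI by auto
  then show ?thesis using M0 M1 M2 TI nTI hl(1) unfolding r by blast
qed

end
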